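(* Let $q$ be a prime power, let $n\ge1$, and let $\alpha\in\mathbb{F}_{q^n}$ be normal over $\mathbb{F}_q$. Suppose $n\mid(q-1)$. Then the number of elements of $\mathbb{F}_{q^n}$ that are $(\alpha,2)$-sociable is $$\prod_{i=1}^n\left(q-\frac{n}{\gcd(i,n)}-1\right).$$
   Context: An element $\alpha\in\mathbb{F}_{q^n}$ is normal (over $\mathbb{F}_q$) if $\alpha,\alpha^q,\ldots,\alpha^{q^{n-1}}$ are linearly independent over $\mathbb{F}_q$. An element $\beta\in\mathbb{F}_{q^n}$ has normal $\alpha$-depth $2$ if $\beta$ and $\beta-\alpha$ are both normal over $\mathbb{F}_q$. The element $\beta$ is $(\alpha,2)$-sociable if $\beta^{q^i}$ has normal $\alpha$-depth $2$ for all $i\ge0$. *)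

theory Defs
  imports "HOL-Algebra.Embedded_Algebras" "HOL-Number_Theory.Prime_Powers"
begin

text \<open>
  In all definitions \<open>L\<close> is a field with \<open>q ^ n\<close> elements and \<open>K\<close> is its subfield with \<open>q\<close>
  elements. Linear independence over \<open>K\<close> is \<open>ring.independent\<close>, applied to the list of
  conjugates, so repeated conjugates count as dependent.
\<close>

definition normal_element ::
  "('a, 'b) ring_scheme \<Rightarrow> 'a set \<Rightarrow> nat \<Rightarrow> nat \<Rightarrow> 'a \<Rightarrow> bool" where
  "normal_element L K q n x \<longleftrightarrow>
     x \<in> carrier L \<and> ring.independent L K (map (\<lambda>i. x [^]\<^bsub>L\<^esub> (q ^ i)) [0..<n])"

definition normal_depth_two ::
  "('a, 'b) ring_scheme \<Rightarrow> 'a set \<Rightarrow> nat \<Rightarrow> nat \<Rightarrow> 'a \<Rightarrow> 'a \<Rightarrow> bool" where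
  "normal_depth_two L K q n a b \<longleftrightarrow>
     normal_element L K q n b \<and> normal_element L K q n (b \<ominus>\<^bsub>L\<^esub> a)"

definition two_sociable ::
  "('a, 'b) ring_scheme \<Rightarrow> 'a set \<Rightarrow> nat \<Rightarrow> nat \<Rightarrow> 'a \<Rightarrow> 'a \<Rightarrow> bool" where
  "two_sociable L K q n a b \<longleftrightarrow>
     (\<forall>i. normal_depth_two L K q n a (b [^]\<^bsub>L\<^esub> (q ^ i)))"

end

theory Submission
  imports Defs "HOL-Algebra.Multiplicative_Group"
begin

text \<open>
  Let \<open>\<sigma>\<close> be the Frobenius map \<open>x \<mapsto> x ^ q\<close>. It is \<open>K\<close>-linear with \<open>\<sigma> ^ n = 1\<close>, and because \<open>n\<close>
  divides \<open>q - 1\<close>, the field \<open>K\<close> contains \<open>n\<close> distinct \<open>n\<close>-th roots of unity. So \<open>\<sigma>\<close> is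
  diagonalizable over \<open>K\<close>, and the Lagrange resolvents
  \<open>R \<omega> x = (\<Sum>i<n. \<omega> ^ i * x ^ (q ^ i))\<close> are its eigenvector components.

  An element is normal iff none of its resolvents vanishes
  (\<open>normal_element_iff_resolvents_nonzero\<close>). For the normal element \<open>\<alpha>\<close> the quotients
  \<open>R \<omega> x / R \<omega> \<alpha>\<close> are fixed by \<open>\<sigma>\<close>, hence lie in \<open>K\<close>, and they are coordinates that identify \<open>L\<close> with
  the functions from the \<open>n\<close>-th roots of unity to \<open>K\<close> (\<open>bij_betw_coordinates\<close>). In these
  coordinates \<open>\<sigma>\<close> divides the entry at \<open>\<omega>\<close> by \<open>\<omega>\<close>, and \<open>\<alpha>\<close> is constantly \<open>1\<close>. Thus \<open>\<beta>\<close> is sociable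
  iff its entry at each \<open>\<omega>\<close> is neither zero nor a power of \<open>\<omega>\<close> (\<open>two_sociable_iff\<close>).

  The entries can be chosen independently, so the count is the product over \<open>\<omega>\<close> of \<open>q - 1\<close> minus the
  order of \<open>\<omega>\<close>. For a primitive root \<open>\<zeta>\<close> the order of \<open>\<zeta> ^ i\<close> is \<open>n div gcd i n\<close>.
\<close>

section \<open>Polynomials with many roots\<close>

lemma (in domain) UP_eq_zero_if_many_roots:
  assumes "finite (carrier R)" "f \<in> carrier (UP R)" "S \<subseteq> carrier R" "deg R f < card S"
    and "\<And>x. x \<in> S \<Longrightarrow> eval R R id x f = \<zero>"
  shows "f = \<zero>\<^bsub>UP R\<^esub>"
proof (rule ccontr)
  interpret UP: UP_domain R "UP R" by unfold_locales
  assume "f \<noteq> \<zero>\<^bsub>UP R\<^esub>"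
  then have "card {a \<in> carrier R. eval R R id a f = \<zero>} \<le> deg R f"
    using UP.roots_bound assms by simp
  moreover have "card S \<le> card {a \<in> carrier R. eval R R id a f = \<zero>}"
    using assms by (intro card_mono) auto
  ultimately show False using assms(4) by linarith
qed

text \<open>
  The root bound for coefficient families instead of polynomials: the columns of a Vandermonde
  matrix with distinct nodes are independent. The nodes will be roots of unity; the coefficients
  will be those of a linear relation between conjugates, or the conjugates themselves.
\<close>

lemma (in domain) power_sum_coefficients_zero:
  fixes n :: nat and c :: "nat \<Rightarrow> 'a"
  assumes "finite (carrier R)" "S \<subseteq> carrier R" "n \<le> card S"
    and c: "\<And>i. i < n \<Longrightarrow> c i \<in> carrier R"
    and eq: "\<And>x. x \<in> S \<Longrightarrow> (\<Oplus>i\<in>{..<n}. c i \<otimes> x [^] i) = \<zero>"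
    and "j < n"
  shows "c j = \<zero>"
proof -
  interpret UP: UP_domain R "UP R" by unfold_locales
  interpret E: UP_pre_univ_prop R R id "UP R" by (unfold_locales; rule id_ring_hom)
  define f where "f = (\<Oplus>\<^bsub>UP R\<^esub>i\<in>{..<n}. monom (UP R) (c i) i)"
  have f: "f \<in> carrier (UP R)"
    unfolding f_def using c by (intro UP.P.finsum_closed) auto
  have coeff: "coeff (UP R) f k = (if k < n then c k else \<zero>)" for k
  proof -
    have "coeff (UP R) f k = (\<Oplus>i\<in>{..<n}. coeff (UP R) (monom (UP R) (c i) i) k)"
      unfolding f_def using c by (intro UP.coeff_finsum) auto
    also have "\<dots> = (\<Oplus>i\<in>{..<n}. if k = i then c i else \<zero>)"
      using c by (intro finsum_cong') auto
    also have "\<dots> = (if k < n then c k else \<zero>)"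
      using c add.finprod_singleton[of k "{..<n}" c] by (auto intro!: add.finprod_one_eqI)
    finally show ?thesis .
  qed
  have "deg R f \<le> n - 1" using f coeff by (intro UP.deg_aboveI) auto
  then have "deg R f < card S" using assms by linarith
  moreover have "eval R R id x f = \<zero>" if "x \<in> S" for x
  proof -
    have x: "x \<in> carrier R" using that assms by auto
    interpret ev: ring_hom_cring "UP R" R "eval R R id x"
      using E.ring_homD[OF E.eval_ring_hom[OF x]] .
    have "eval R R id x f = (\<Oplus>i\<in>{..<n}. (eval R R id x \<circ> (\<lambda>i. monom (UP R) (c i) i)) i)"
      unfolding f_def using c by (intro ev.hom_finsum) auto
    also have "\<dots> = (\<Oplus>i\<in>{..<n}. c i \<otimes> x [^] i)"
      using c x by (intro finsum_cong') (auto simp: UP.evalRR_monom)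
    finally show ?thesis using eq that by simp
  qed
  ultimately have "f = \<zero>\<^bsub>UP R\<^esub>" using UP_eq_zero_if_many_roots f assms by blast
  then show ?thesis using coeff[of j] assms by simp
qed

section \<open>The Frobenius map of a finite field extension\<close>

text \<open>
  All that the additivity of the Frobenius map needs from the binomial theorem:
  \<open>(X + 1) ^ m - X ^ m\<close> has degree below \<open>m\<close>.
\<close>

lemma (in domain) power_of_succ_minus_leading:
  assumes "(m :: nat) \<ge> 1"
  shows "\<exists>p \<in> carrier (UP R). deg R p < m \<and>
    (\<forall>x \<in> carrier R. (x \<oplus> \<one>) [^] m = x [^] m \<oplus> eval R R id x p)"
  using assms
proof (induction m rule: dec_induct)
  interpret UP: UP_domain R "UP R" by unfold_locales
  case base
  show ?case
  proof (intro bexI[of _ "\<one>\<^bsub>UP R\<^esub>"] conjI ballI)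
    fix x assume x: "x \<in> carrier R"
    show "(x \<oplus> \<one>) [^] (1::nat) = x [^] (1::nat) \<oplus> eval R R id x \<one>\<^bsub>UP R\<^esub>"
      unfolding UP.evalRR_one[OF x] using x by simp
  qed auto
next
  interpret UP: UP_domain R "UP R" by unfold_locales
  case (step m)
  then obtain p where p: "p \<in> carrier (UP R)" "deg R p < m"
    "\<And>x. x \<in> carrier R \<Longrightarrow> (x \<oplus> \<one>) [^] m = x [^] m \<oplus> eval R R id x p" by blast
  \<comment> \<open>The next polynomial is \<open>X ^ m + (X + 1) * p\<close>.\<close>
  define l where "l = monom (UP R) \<one> 1 \<oplus>\<^bsub>UP R\<^esub> \<one>\<^bsub>UP R\<^esub>"
  define p' where "p' = monom (UP R) \<one> m \<oplus>\<^bsub>UP R\<^esub> l \<otimes>\<^bsub>UP R\<^esub> p"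
  have l: "l \<in> carrier (UP R)" by (simp add: l_def)
  have "deg R l \<le> 1" unfolding l_def
    by (rule order.trans[OF UP.deg_add]) auto
  then have "deg R (l \<otimes>\<^bsub>UP R\<^esub> p) \<le> m"
    using UP.deg_mult_ring[OF l p(1)] p(2) by linarith
  then have "deg R p' \<le> m"
    unfolding p'_def using l p by (intro order.trans[OF UP.deg_add]) auto
  moreover have "(x \<oplus> \<one>) [^] Suc m = x [^] Suc m \<oplus> eval R R id x p'" if x: "x \<in> carrier R" for x
  proof -
    define e where "e = eval R R id x p"
    have e: "e \<in> carrier R" using UP.carrier_evalRR x p by (simp add: e_def)
    have "eval R R id x p' = x [^] m \<oplus> (x \<oplus> \<one>) \<otimes> e"
      using x p l by (simp add: p'_def l_def e_def UP.evalRR_simps)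
    moreover have "(x \<oplus> \<one>) [^] Suc m = (x [^] m \<oplus> e) \<otimes> (x \<oplus> \<one>)"
      using p(3) x by (simp add: e_def)
    moreover have "(x [^] m \<oplus> e) \<otimes> (x \<oplus> \<one>) = x [^] Suc m \<oplus> (x [^] m \<oplus> (x \<oplus> \<one>) \<otimes> e)"
    proof -
      define y where "y = x [^] m"
      have "y \<in> carrier R" using x by (simp add: y_def)
      then show ?thesis using x e unfolding nat_pow_Suc y_def[symmetric] by algebra
    qed
    ultimately show ?thesis by simp
  qed
  moreover have "p' \<in> carrier (UP R)" using l p by (simp add: p'_def)
  ultimately show ?case by (metis le_imp_less_Suc)
qed

lemma (in field) finite_field_pow_order:
  assumes "finite (carrier R)" "x \<in> carrier R"
  shows "x [^] order R = x"
proof (cases "x = \<zero>")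
  case True
  have "order R > 0" using assms by (simp add: order_def card_gt_0_iff) auto
  then show ?thesis using True by (simp add: nat_pow_zero)
next
  case False
  interpret G: group "mult_of R" by (rule field_mult_group)
  have "order R > 0" using assms by (simp add: order_def card_gt_0_iff) auto
  moreover have "x [^] (order R - 1) = \<one>"
    using G.pow_order_eq_1[of x] assms False by (simp add: order_mult_of nat_pow_mult_of)
  ultimately show ?thesis using assms nat_pow_Suc[of x "order R - 1"] by simp
qed

lemma (in field) subfield_pow_card:
  assumes "subfield K R" "finite K" "x \<in> K"
  shows "x [^] card K = x"
  using field.finite_field_pow_order[OF subfield_iff(2)[OF assms(1)], of x] assms
  by (simp add: order_def nat_pow_consistent[symmetric])

text \<open>
  Let \<open>q = card K\<close>. The polynomial \<open>(X + 1) ^ q - X ^ q - 1\<close> has degree below \<open>q\<close> and vanishes at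
  the \<open>q\<close> elements of \<open>K\<close>, where \<open>x ^ q = x\<close>; so it is zero, and \<open>(x + 1) ^ q = x ^ q + 1\<close> holds in
  the whole field. Homogeneity gives the rest. This argument avoids the characteristic and the
  divisibility of binomial coefficients.
\<close>

lemma (in field) frobenius_add:
  assumes "finite (carrier R)" "subfield K R" "x \<in> carrier R" "y \<in> carrier R"
  shows "(x \<oplus> y) [^] card K = x [^] card K \<oplus> y [^] card K"
proof -
  interpret UP: UP_domain R "UP R" by unfold_locales
  let ?q = "card K"
  have K: "K \<subseteq> carrier R" using subfieldE(3) assms by auto
  have finK: "finite K" using K assms(1) by (rule finite_subset)
  have "\<zero> \<in> K" "\<one> \<in> K" using subringE(2,3)[OF subfieldE(1)[OF assms(2)]] by auto
  then have "card {\<zero>, \<one>} \<le> ?q" using finK by (intro card_mono) auto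
  then have q: "?q \<ge> 2" by simp
  then obtain p where p: "p \<in> carrier (UP R)" "deg R p < ?q"
    "\<And>x. x \<in> carrier R \<Longrightarrow> (x \<oplus> \<one>) [^] ?q = x [^] ?q \<oplus> eval R R id x p"
    using power_of_succ_minus_leading[of ?q] by fastforce
  define f where "f = p \<ominus>\<^bsub>UP R\<^esub> \<one>\<^bsub>UP R\<^esub>"
  have f: "f \<in> carrier (UP R)" using p by (simp add: f_def)
  have ev: "eval R R id x f = eval R R id x p \<ominus> \<one>" if "x \<in> carrier R" for x
    using that p by (simp add: f_def UP.evalRR_simps)
  have "deg R f < ?q"
    using UP.deg_add[of p "\<ominus>\<^bsub>UP R\<^esub> \<one>\<^bsub>UP R\<^esub>"] p unfolding f_def a_minus_def by auto
  moreover have "eval R R id x f = \<zero>" if x: "x \<in> K" for x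
  proof -
    have x': "x \<in> carrier R" using x K by auto
    have "x \<oplus> \<one> \<in> K"
      using subringE(7)[OF subfieldE(1)[OF assms(2)] x \<open>\<one> \<in> K\<close>] .
    then have "x \<oplus> \<one> = x \<oplus> eval R R id x p"
      using p(3)[OF x'] subfield_pow_card[OF assms(2) finK] x by simp
    then have "eval R R id x p = \<one>"
      using x' UP.carrier_evalRR[OF x' p(1)] by simp
    then show ?thesis using ev[OF x'] by simp
  qed
  ultimately have "f = \<zero>\<^bsub>UP R\<^esub>" using UP_eq_zero_if_many_roots[OF assms(1) f K] by simp
  then have "p = \<one>\<^bsub>UP R\<^esub>" using p unfolding f_def by simp
  then have succ: "(x \<oplus> \<one>) [^] ?q = x [^] ?q \<oplus> \<one>" if "x \<in> carrier R" for x
    using p(3)[OF that] that by (simp add: UP.evalRR_simps)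
  show ?thesis
  proof (cases "y = \<zero>")
    case True
    then show ?thesis using assms q by (simp add: nat_pow_zero)
  next
    case False
    then have y: "y \<in> Units R" using assms field_Units by auto
    define z where "z = x \<otimes> inv y"
    have z: "z \<in> carrier R" using y assms by (simp add: z_def)
    have x: "x = z \<otimes> y" using y assms by (simp add: z_def m_assoc)
    have "(x \<oplus> y) [^] ?q = ((z \<oplus> \<one>) \<otimes> y) [^] ?q"
      using z assms by (simp add: x l_distr)
    also have "\<dots> = (z [^] ?q \<oplus> \<one>) \<otimes> y [^] ?q"
      using z assms succ by (simp add: nat_pow_distrib)
    also have "\<dots> = x [^] ?q \<oplus> y [^] ?q"
      using z assms by (simp add: x l_distr nat_pow_distrib)
    finally show ?thesis .
  qed
qed

text \<open>
  The nonzero elements of \<open>K\<close> already are \<open>q - 1\<close> roots of \<open>X ^ (q - 1) - 1\<close>, hence all of them.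
\<close>

lemma (in field) fixed_by_frobenius_iff:
  assumes "finite (carrier R)" "subfield K R" "x \<in> carrier R"
  shows "x [^] card K = x \<longleftrightarrow> x \<in> K"
proof
  have K: "K \<subseteq> carrier R" using subfieldE(3) assms by auto
  have finK: "finite K" using K assms(1) by (rule finite_subset)
  then show "x [^] card K = x" if "x \<in> K" using that subfield_pow_card assms by blast
  have 01: "\<zero> \<in> K" "\<one> \<in> K" using subringE(2,3)[OF subfieldE(1)[OF assms(2)]] by auto
  then have "card {\<zero>, \<one>} \<le> card K" using finK by (intro card_mono) auto
  then have q: "card K \<ge> 2" by simp
  have unity: "y [^] (card K - 1) = \<one>" if "y \<in> carrier R" "y \<noteq> \<zero>" "y [^] card K = y" for y
  proof -
    have "y [^] (card K - 1) \<otimes> y = \<one> \<otimes> y"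
      using that q nat_pow_Suc[of y "card K - 1"] by simp
    then show ?thesis using that m_rcancel by (metis nat_pow_closed one_closed)
  qed
  have "K - {\<zero>} \<subseteq> {y \<in> carrier R. y [^] (card K - 1) = \<one>}"
    using K unity subfield_pow_card[OF assms(2) finK] by auto
  moreover have "card {y \<in> carrier R. y [^] (card K - 1) = \<one>} \<le> card (K - {\<zero>})"
    using num_roots_le_deg[OF assms(1), of "card K - 1"] q 01 finK by simp
  ultimately have "K - {\<zero>} = {y \<in> carrier R. y [^] (card K - 1) = \<one>}"
    using assms(1) by (intro card_seteq) auto
  then show "x \<in> K" if "x [^] card K = x"
    using unity[OF assms(3) _ that] assms(3) 01 by (cases "x = \<zero>") blast+
qed

lemma (in field) primitive_root_of_unity_exists:
  assumes "finite (carrier R)" "n dvd order R - 1"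
  obtains \<zeta> where "\<zeta> \<in> carrier (mult_of R)" "group.ord (mult_of R) \<zeta> = n"
proof -
  interpret G: group "mult_of R" by (rule field_mult_group)
  have fin: "finite (carrier (mult_of R))" using assms by simp
  obtain g where g: "g \<in> carrier (mult_of R)"
    and gen: "carrier (mult_of R) = {g [^] i | i::nat. i \<in> UNIV}"
    using finite_field_mult_group_has_gen[OF assms(1)] by auto
  have "G.ord g = card (carrier (mult_of R))"
    using G.generate_pow_card[OF g] G.generate_pow_on_finite_carrier[OF fin g] gen
    by (simp add: nat_pow_mult_of)
  then have ord: "G.ord g = order R - 1" using assms by (simp add: order_mult_of flip: order_def)
  have pos: "order R - 1 > 0" using G.ord_ge_1[OF fin g] ord by simp
  obtain m where m: "order R - 1 = n * m" using assms by auto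
  have "G.ord (g [^]\<^bsub>mult_of R\<^esub> m) = n"
    using G.ord_pow[OF g, of m] m pos ord by simp
  then show thesis using that g G.nat_pow_closed by blast
qed

section \<open>Linear independence of indexed families\<close>

lemma (in ring) combine_map_upt:
  assumes "length Ks = n" "set Ks \<subseteq> carrier R" "\<And>i. i < n \<Longrightarrow> u i \<in> carrier R"
  shows "combine Ks (map u [0..<n]) = (\<Oplus>i\<in>{..<n}. Ks ! i \<otimes> u i)"
  using assms
proof (induction n arbitrary: Ks)
  case 0
  then show ?case by simp
next
  case (Suc n)
  define Ks' where "Ks' = butlast Ks"
  define k where "k = last Ks"
  have Ks: "Ks = Ks' @ [k]" using Suc.prems(1) unfolding Ks'_def k_def by (metis append_butlast_last_id list.size(3) nat.distinct(1))
  have len: "length Ks' = n" using Suc.prems(1) Ks by simp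
  have c: "set Ks' \<subseteq> carrier R" "k \<in> carrier R" using Suc.prems(2) Ks by auto
  have u: "set (map u [0..<n]) \<subseteq> carrier R" "u n \<in> carrier R" using Suc.prems(3) by auto
  have Ki: "Ks ! i \<in> carrier R" if "i < Suc n" for i
    using Suc.prems(1) that by (intro subsetD[OF Suc.prems(2)] nth_mem) simp
  have "combine Ks (map u [0..<Suc n]) = combine (Ks' @ [k]) (map u [0..<n] @ [u n])"
    by (simp add: Ks)
  moreover have "\<dots> = combine Ks' (map u [0..<n]) \<oplus> combine [k] [u n]"
    using c u len by (intro combine_append[symmetric]) auto
  moreover have "combine Ks' (map u [0..<n]) = (\<Oplus>i\<in>{..<n}. Ks' ! i \<otimes> u i)"
    using Suc c len by simp
  moreover have "\<dots> = (\<Oplus>i\<in>{..<n}. Ks ! i \<otimes> u i)"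
  proof (intro finsum_cong')
    fix i assume "i \<in> {..<n}"
    then show "Ks' ! i \<otimes> u i = Ks ! i \<otimes> u i" using len by (simp add: Ks nth_append)
  qed (use Ki Suc.prems(3) in auto)
  moreover have "combine [k] [u n] = Ks ! n \<otimes> u n"
    using len c u by (simp add: Ks nth_append)
  moreover have "(\<Oplus>i\<in>{..<Suc n}. Ks ! i \<otimes> u i) =
      Ks ! n \<otimes> u n \<oplus> (\<Oplus>i\<in>{..<n}. Ks ! i \<otimes> u i)"
    unfolding lessThan_Suc using Ki Suc.prems(3) by (intro finsum_insert) auto
  moreover have "(\<Oplus>i\<in>{..<n}. Ks ! i \<otimes> u i) \<in> carrier R"
    using Ki Suc.prems(3) by (intro finsum_closed) auto
  ultimately show ?case using a_comm Ki[of n] Suc.prems(3)[of n] by simp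
qed

lemma (in ring) independent_map_upt_iff:
  assumes K: "subfield K R" and u: "\<And>i. i < n \<Longrightarrow> u i \<in> carrier R"
  shows "independent K (map u [0..<n]) \<longleftrightarrow>
    (\<forall>c. (\<forall>i<n. c i \<in> K) \<longrightarrow> (\<Oplus>i\<in>{..<n}. c i \<otimes> u i) = \<zero> \<longrightarrow> (\<forall>i<n. c i = \<zero>))"
    (is "_ \<longleftrightarrow> ?R")
proof -
  note KR = subfieldE(3)[OF K]
  have us: "set (map u [0..<n]) \<subseteq> carrier R" using u by auto
  show ?thesis
  proof
    assume ind: "independent K (map u [0..<n])"
    show ?R
    proof (intro allI impI)
      fix c i assume c: "\<forall>i<n. c i \<in> K" "(\<Oplus>i\<in>{..<n}. c i \<otimes> u i) = \<zero>" and i: "i < n"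
      have "combine (map c [0..<n]) (map u [0..<n]) = (\<Oplus>i\<in>{..<n}. map c [0..<n] ! i \<otimes> u i)"
        using c KR u by (intro combine_map_upt) auto
      also have "\<dots> = (\<Oplus>i\<in>{..<n}. c i \<otimes> u i)"
        using c KR u by (intro finsum_cong') auto
      finally have "set (take (length (map u [0..<n])) (map c [0..<n])) \<subseteq> {\<zero>}"
        using c by (intro independent_imp_trivial_combine[OF K ind]) auto
      then show "c i = \<zero>" using i by force
    qed
  next
    assume R: ?R
    show "independent K (map u [0..<n])"
    proof (rule ccontr)
      assume dep: "dependent K (map u [0..<n])"
      then obtain Ks where Ks: "length Ks = n" "combine Ks (map u [0..<n]) = \<zero>"
        "set Ks \<subseteq> K" "set Ks \<noteq> {\<zero>}"
        using dependent_imp_non_trivial_combine[OF K us] by (metis length_map length_upt diff_zero)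
      have "(\<Oplus>i\<in>{..<n}. Ks ! i \<otimes> u i) = \<zero>"
        using combine_map_upt[OF Ks(1) _ u] Ks KR by auto
      moreover have "\<forall>i<n. Ks ! i \<in> K" using Ks nth_mem by blast
      ultimately have "\<forall>i<n. Ks ! i = \<zero>" using R by blast
      then have "set Ks \<subseteq> {\<zero>}" using Ks(1) by (auto simp: in_set_conv_nth)
      then have "n = 0" using Ks(1,4) by (auto simp: subset_singleton_iff)
      then show False using dep by simp
    qed
  qed
qed

section \<open>Extensions whose degree divides q - 1\<close>

locale cyclic_extension = field L for L (structure) +
  fixes K :: "'a set" and q n :: nat
  assumes finite_L: "finite (carrier L)" and order_L: "order L = q ^ n"
    and subfield_K: "subfield K L" and card_K: "card K = q"
    and n_pos: "n \<ge> 1" and n_dvd: "n dvd q - 1"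
begin

definition roots_of_unity :: "'a set" where
  "roots_of_unity = {\<omega> \<in> carrier L. \<omega> [^] n = \<one>}"

text \<open>
  The Lagrange resolvent. Up to the scalar \<open>n\<close> it is the projection to an eigenspace of the
  Frobenius map, the one for the eigenvalue \<open>inverse \<omega>\<close>.
\<close>

definition resolvent :: "'a \<Rightarrow> 'a \<Rightarrow> 'a" where
  "resolvent \<omega> x = (\<Oplus>i\<in>{..<n}. \<omega> [^] i \<otimes> x [^] (q ^ i))"

lemma K_subset: "K \<subseteq> carrier L"
  using subfieldE(3)[OF subfield_K] .

lemma finite_K: "finite K"
  using K_subset finite_L by (rule finite_subset)

lemma zero_one_in_K: "\<zero> \<in> K" "\<one> \<in> K"
  using subringE(2,3)[OF subfieldE(1)[OF subfield_K]] by auto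

lemma q_ge_2: "q \<ge> 2"
proof -
  have "card {\<zero>, \<one>} \<le> card K" using zero_one_in_K finite_K by (intro card_mono) auto
  then show ?thesis by (simp add: card_K)
qed

lemma in_K_iff: "x \<in> carrier L \<Longrightarrow> x \<in> K \<longleftrightarrow> x [^] q = x"
  using fixed_by_frobenius_iff[OF finite_L subfield_K] card_K by auto

lemma frobenius_plus:
  "x \<in> carrier L \<Longrightarrow> y \<in> carrier L \<Longrightarrow> (x \<oplus> y) [^] q = x [^] q \<oplus> y [^] q"
  using frobenius_add[OF finite_L subfield_K] card_K by auto

lemma frobenius_power_Suc: "x \<in> carrier L \<Longrightarrow> x [^] (q ^ Suc i) = (x [^] (q ^ i)) [^] q"
  by (simp add: nat_pow_pow mult.commute)

lemma frobenius_power_plus: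
  assumes "x \<in> carrier L" "y \<in> carrier L"
  shows "(x \<oplus> y) [^] (q ^ i) = x [^] (q ^ i) \<oplus> y [^] (q ^ i)"
proof (induction i)
  case 0
  then show ?case using assms by simp
next
  case (Suc i)
  then show ?case using assms frobenius_plus by (simp only: frobenius_power_Suc a_closed nat_pow_closed)
qed

lemma frobenius_power_K: "x \<in> K \<Longrightarrow> x [^] (q ^ i) = x"
proof (induction i)
  case 0
  then show ?case using K_subset by auto
next
  case (Suc i)
  then have "x \<in> carrier L" using K_subset by auto
  then show ?case using Suc in_K_iff by (simp only: frobenius_power_Suc)
qed

lemma frobenius_power_n: "x \<in> carrier L \<Longrightarrow> x [^] (q ^ n) = x"
  using finite_field_pow_order[OF finite_L] order_L by simp

lemma frobenius_finsum:
  assumes "finite A" "f \<in> A \<rightarrow> carrier L"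
  shows "(\<Oplus>i\<in>A. f i) [^] q = (\<Oplus>i\<in>A. f i [^] q)"
  using assms
proof (induction A rule: finite_induct)
  case empty
  then show ?case using q_ge_2 by (simp add: nat_pow_zero)
next
  case (insert a A)
  then have "f a \<in> carrier L" "f \<in> A \<rightarrow> carrier L" "(\<lambda>i. f i [^] q) \<in> A \<rightarrow> carrier L" by auto
  then show ?case using insert frobenius_plus by simp
qed

section \<open>Roots of unity\<close>

text \<open>
  As \<open>n\<close> divides \<open>q - 1\<close>, the roots of unity are fixed by the Frobenius map and lie in \<open>K\<close>;
  it is this that makes the resolvents \<open>K\<close>-linear combinations of conjugates.
\<close>

lemma root_of_unityD:
  assumes "\<omega> \<in> roots_of_unity"
  shows "\<omega> \<in> carrier L" "\<omega> [^] n = \<one>" "\<omega> \<in> K" "\<omega> \<noteq> \<zero>"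
proof -
  show w: "\<omega> \<in> carrier L" "\<omega> [^] n = \<one>" using assms by (auto simp: roots_of_unity_def)
  obtain m where m: "q - 1 = n * m" using n_dvd by auto
  have "Suc (n * m) = q" using m q_ge_2 by linarith
  have "\<omega> [^] (n * m) = (\<omega> [^] n) [^] m" by (simp only: nat_pow_pow[OF w(1)])
  then have "\<omega> [^] Suc (n * m) = \<omega>" using w by simp
  then have "\<omega> [^] q = \<omega>" unfolding \<open>Suc (n * m) = q\<close> .
  then show "\<omega> \<in> K" using w in_K_iff by simp
  show "\<omega> \<noteq> \<zero>" using w n_pos by (auto simp: nat_pow_zero)
qed

lemma root_of_unity_pow:
  fixes i :: nat
  assumes "\<omega> \<in> roots_of_unity"
  shows "\<omega> [^] i \<in> roots_of_unity"
proof -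
  note w = root_of_unityD(1,2)[OF assms]
  have "(\<omega> [^] i) [^] n = (\<omega> [^] n) [^] i" by (simp only: nat_pow_pow[OF w(1)] mult.commute)
  then show ?thesis using w by (simp add: roots_of_unity_def)
qed

lemma inv_root_of_unity:
  assumes "\<omega> \<in> roots_of_unity"
  shows "inv \<omega> \<in> roots_of_unity"
proof -
  have U: "\<omega> \<in> Units L" using root_of_unityD[OF assms] field_Units by auto
  then have "inv \<omega> [^] n \<otimes> \<omega> [^] n = (inv \<omega> \<otimes> \<omega>) [^] n"
    by (intro nat_pow_distrib[symmetric]) auto
  then show ?thesis using root_of_unityD[OF assms] U by (simp add: roots_of_unity_def)
qed

text \<open>
  The powers of a primitive root \<open>\<zeta>\<close> index the roots of unity by \<open>{1..n}\<close>. The second part is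
  where the factors of the final product come from: \<open>\<zeta> ^ i\<close> has order \<open>n div gcd i n\<close>, and the values
  that a coordinate at \<open>\<zeta> ^ i\<close> has to avoid are the powers of \<open>\<zeta> ^ i\<close> and zero.
\<close>

lemma primitive_root:
  obtains \<zeta> where "bij_betw (\<lambda>i. \<zeta> [^] i) {1..n} roots_of_unity"
    "\<And>i. i \<in> {1..n} \<Longrightarrow> card (insert \<zero> (range (\<lambda>j::nat. (\<zeta> [^] i) [^] j))) = Suc (n div gcd i n)"
proof -
  interpret G: group "mult_of L" by (rule field_mult_group)
  have fin: "finite (carrier (mult_of L))" using finite_L by simp
  have "q - 1 dvd q ^ n - 1"
  proof -
    obtain k where q: "q = Suc k" using q_ge_2 by (cases q) auto
    have "\<exists>m. Suc k ^ n = Suc (k * m)"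
    proof (induction n)
      case (Suc n)
      then obtain m where "Suc k ^ n = Suc (k * m)" by auto
      then have "Suc k ^ Suc n = Suc (k * (m * Suc k + 1))" by (simp add: algebra_simps)
      then show ?case ..
    qed (auto intro: exI[of _ 0])
    then show ?thesis by (auto simp: q)
  qed
  then have "n dvd order L - 1" using n_dvd order_L dvd_trans by metis
  then obtain \<zeta> where z: "\<zeta> \<in> carrier (mult_of L)" and ord: "G.ord \<zeta> = n"
    using primitive_root_of_unity_exists[OF finite_L] by metis
  have zn: "\<zeta> [^] n = \<one>" using G.pow_ord_eq_1[OF z] ord by (simp add: nat_pow_mult_of)
  have zL: "\<zeta> \<in> carrier L" using z by simp
  have inj: "inj_on (\<lambda>i. \<zeta> [^] i) {1..n}"
    using G.ord_inj'[OF z] ord by (simp add: nat_pow_mult_of)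
  have sub: "(\<lambda>i. \<zeta> [^] i) ` {1..n} \<subseteq> roots_of_unity"
  proof clarify
    fix i :: nat
    have "(\<zeta> [^] i) [^] n = (\<zeta> [^] n) [^] i" using zL by (simp only: nat_pow_pow mult.commute)
    then show "\<zeta> [^] i \<in> roots_of_unity" using zL zn by (simp add: roots_of_unity_def)
  qed
  have "card roots_of_unity \<le> card ((\<lambda>i. \<zeta> [^] i) ` {1..n})"
    using num_roots_le_deg[OF finite_L, of n] n_pos card_image[OF inj]
    by (simp add: roots_of_unity_def)
  moreover have "finite roots_of_unity" using finite_L by (simp add: roots_of_unity_def)
  ultimately have "(\<lambda>i. \<zeta> [^] i) ` {1..n} = roots_of_unity"
    using sub by (intro card_seteq)
  then have bij: "bij_betw (\<lambda>i. \<zeta> [^] i) {1..n} roots_of_unity"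
    using inj by (simp add: bij_betw_def)
  have "card (insert \<zero> (range (\<lambda>j::nat. (\<zeta> [^] i) [^] j))) = Suc (n div gcd i n)"
    if i: "i \<in> {1..n}" for i
  proof -
    have w: "\<zeta> [^] i \<in> carrier (mult_of L)" using G.nat_pow_closed[OF z, of i] by (simp only: nat_pow_mult_of)
    have "range (\<lambda>j::nat. (\<zeta> [^] i) [^] j) = generate (mult_of L) {\<zeta> [^] i}"
      using G.generate_pow_on_finite_carrier[OF fin w] by (auto simp: nat_pow_mult_of)
    then have "card (range (\<lambda>j::nat. (\<zeta> [^] i) [^] j)) = G.ord (\<zeta> [^] i)"
      using G.generate_pow_card[OF w] by simp
    also have "\<dots> = n div gcd i n"
      using G.ord_pow_gen[OF z, of i] i ord by (simp add: nat_pow_mult_of gcd.commute)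
    finally have card: "card (range (\<lambda>j::nat. (\<zeta> [^] i) [^] j)) = n div gcd i n" .
    have sub: "range (\<lambda>j::nat. (\<zeta> [^] i) [^] j) \<subseteq> carrier L - {\<zero>}"
      using G.nat_pow_closed[OF w] by (auto simp: nat_pow_mult_of)
    then have "finite (range (\<lambda>j::nat. (\<zeta> [^] i) [^] j))"
      using finite_L by (meson finite_Diff finite_subset)
    moreover have "\<zero> \<notin> range (\<lambda>j::nat. (\<zeta> [^] i) [^] j)" using sub by blast
    ultimately show ?thesis using card by (subst card_insert_disjoint) auto
  qed
  then show thesis using that bij by blast
qed

lemma card_roots_of_unity: "card roots_of_unity = n"
proof -
  obtain \<zeta> where "bij_betw (\<lambda>i. \<zeta> [^] i) {1..n} roots_of_unity" by (rule primitive_root)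
  then show ?thesis using bij_betw_same_card by fastforce
qed

lemma finite_roots_of_unity: "finite roots_of_unity"
  using finite_L by (simp add: roots_of_unity_def)

lemma coefficients_zero_at_roots_of_unity:
  assumes "\<And>i. i < n \<Longrightarrow> c i \<in> carrier L"
    and "\<And>\<omega>. \<omega> \<in> roots_of_unity \<Longrightarrow> (\<Oplus>i\<in>{..<n}. c i \<otimes> \<omega> [^] i) = \<zero>"
    and "j < n"
  shows "c j = \<zero>"
proof (rule power_sum_coefficients_zero[OF finite_L])
  show "roots_of_unity \<subseteq> carrier L" by (auto simp: roots_of_unity_def)
  show "n \<le> card roots_of_unity" by (simp add: card_roots_of_unity)
qed (fact assms)+

section \<open>Lagrange resolvents\<close>

lemma resolvent_closed:
  "\<omega> \<in> roots_of_unity \<Longrightarrow> x \<in> carrier L \<Longrightarrow> resolvent \<omega> x \<in> carrier L"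
  unfolding resolvent_def using root_of_unityD by (intro finsum_closed) auto

lemma resolvent_plus:
  assumes "\<omega> \<in> roots_of_unity" "x \<in> carrier L" "y \<in> carrier L"
  shows "resolvent \<omega> (x \<oplus> y) = resolvent \<omega> x \<oplus> resolvent \<omega> y"
proof -
  have w: "\<omega> \<in> carrier L" using assms root_of_unityD by auto
  have "resolvent \<omega> (x \<oplus> y) =
      (\<Oplus>i\<in>{..<n}. \<omega> [^] i \<otimes> x [^] (q ^ i) \<oplus> \<omega> [^] i \<otimes> y [^] (q ^ i))"
    unfolding resolvent_def using assms w
    by (intro finsum_cong') (auto simp: frobenius_power_plus r_distr)
  also have "\<dots> = resolvent \<omega> x \<oplus> resolvent \<omega> y"
    unfolding resolvent_def using assms w by (intro finsum_addf) auto
  finally show ?thesis .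
qed

lemma resolvent_smult:
  assumes "\<omega> \<in> roots_of_unity" "c \<in> K" "x \<in> carrier L"
  shows "resolvent \<omega> (c \<otimes> x) = c \<otimes> resolvent \<omega> x"
proof -
  have w: "\<omega> \<in> carrier L" "c \<in> carrier L" using assms root_of_unityD K_subset by auto
  have "resolvent \<omega> (c \<otimes> x) = (\<Oplus>i\<in>{..<n}. c \<otimes> (\<omega> [^] i \<otimes> x [^] (q ^ i)))"
    unfolding resolvent_def using assms w
    by (intro finsum_cong') (auto simp: nat_pow_distrib frobenius_power_K m_lcomm)
  also have "\<dots> = c \<otimes> resolvent \<omega> x"
    unfolding resolvent_def using assms w by (intro finsum_rdistr[symmetric]) auto
  finally show ?thesis .
qed

lemma resolvent_zero: "\<omega> \<in> roots_of_unity \<Longrightarrow> resolvent \<omega> \<zero> = \<zero>"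
  using resolvent_smult[of \<omega> \<zero> \<zero>] resolvent_closed[of \<omega> \<zero>] zero_one_in_K by simp

lemma resolvent_minus:
  assumes "\<omega> \<in> roots_of_unity" "x \<in> carrier L" "y \<in> carrier L"
  shows "resolvent \<omega> (x \<ominus> y) = resolvent \<omega> x \<ominus> resolvent \<omega> y"
proof -
  define d where "d = resolvent \<omega> (x \<ominus> y)"
  have "d \<oplus> resolvent \<omega> y = resolvent \<omega> x"
    using assms resolvent_plus[of \<omega> "x \<ominus> y" y] by (simp add: d_def a_minus_def a_assoc l_neg)
  moreover have "d \<in> carrier L" "resolvent \<omega> y \<in> carrier L"
    using assms resolvent_closed by (auto simp: d_def)
  ultimately have "d = resolvent \<omega> x \<ominus> resolvent \<omega> y"
    by (metis a_assoc a_inv_closed a_minus_def r_neg r_zero)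
  then show ?thesis by (simp add: d_def)
qed

lemma resolvent_finsum:
  assumes "\<omega> \<in> roots_of_unity" "finite A" "f \<in> A \<rightarrow> carrier L"
  shows "resolvent \<omega> (\<Oplus>i\<in>A. f i) = (\<Oplus>i\<in>A. resolvent \<omega> (f i))"
  using assms(2,3)
proof (induction A rule: finite_induct)
  case empty
  then show ?case using assms resolvent_zero by simp
next
  case (insert a A)
  then have "f a \<in> carrier L" "f \<in> A \<rightarrow> carrier L" "(\<lambda>i. resolvent \<omega> (f i)) \<in> A \<rightarrow> carrier L"
    using resolvent_closed assms by auto
  then show ?case using insert assms resolvent_plus resolvent_closed by simp
qed

text \<open>
  Applying the Frobenius map to the argument shifts the sum cyclically, because both \<open>\<omega> ^ i\<close> and
  \<open>x ^ (q ^ i)\<close> have period \<open>n\<close> in \<open>i\<close>. The factor \<open>\<omega>\<close> stands on the left so that no inverse is needed.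
\<close>

lemma resolvent_frobenius:
  assumes "\<omega> \<in> roots_of_unity" "x \<in> carrier L"
  shows "\<omega> \<otimes> resolvent \<omega> (x [^] q) = resolvent \<omega> x"
proof -
  have w: "\<omega> \<in> carrier L" "\<omega> [^] n = \<one>" using assms root_of_unityD by auto
  define g where "g i = \<omega> [^] i \<otimes> x [^] (q ^ i)" for i :: nat
  have g: "g i \<in> carrier L" for i using w assms by (simp add: g_def)
  have "\<omega> \<otimes> resolvent \<omega> (x [^] q) = (\<Oplus>i\<in>{..<n}. \<omega> \<otimes> (\<omega> [^] i \<otimes> (x [^] q) [^] (q ^ i)))"
    unfolding resolvent_def using assms w by (intro finsum_rdistr) auto
  also have "\<dots> = (\<Oplus>i\<in>{..<n}. g (Suc i))"
    unfolding g_def using assms w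
    by (intro finsum_cong') (auto simp: nat_pow_pow m_assoc[symmetric] m_comm)
  also have "\<dots> = (\<Oplus>i\<in>{..<n}. g i)"
  proof -
    \<comment> \<open>Both sums are the sum over \<open>{..n}\<close> without one of the equal end terms.\<close>
    have "g n = g 0" using assms w frobenius_power_n by (simp add: g_def)
    moreover obtain m where m: "n = Suc m" using n_pos by (cases n) auto
    have "{..<n} = {..m}" using m by auto
    then have "(\<Oplus>i\<in>{..<n}. g (Suc i)) = (\<Oplus>i\<in>{..m}. g (Suc i))"
      "(\<Oplus>i\<in>{..<n}. g i) = (\<Oplus>i\<in>{..m}. g i)" by simp_all
    moreover have "(\<Oplus>i\<in>{..Suc m}. g i) = g (Suc m) \<oplus> (\<Oplus>i\<in>{..m}. g i)"
      using g by (intro finsum_Suc) auto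
    moreover have "(\<Oplus>i\<in>{..Suc m}. g i) = (\<Oplus>i\<in>{..m}. g (Suc i)) \<oplus> g 0"
      using g by (intro finsum_Suc2) auto
    moreover have "(\<Oplus>i\<in>{..m}. g i) \<in> carrier L" "(\<Oplus>i\<in>{..m}. g (Suc i)) \<in> carrier L"
      using g by (auto intro!: finsum_closed)
    ultimately show ?thesis using g[of 0] m by (simp add: a_comm)
  qed
  finally show ?thesis by (simp add: resolvent_def g_def)
qed

lemma resolvent_frobenius_power:
  assumes "\<omega> \<in> roots_of_unity" "x \<in> carrier L"
  shows "\<omega> [^] i \<otimes> resolvent \<omega> (x [^] (q ^ i)) = resolvent \<omega> x"
proof (induction i)
  case 0
  then show ?case using assms resolvent_closed by simp
next
  case (Suc i)
  have w: "\<omega> \<in> carrier L" using assms root_of_unityD by auto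
  have "\<omega> [^] Suc i \<otimes> resolvent \<omega> (x [^] (q ^ Suc i)) =
      \<omega> [^] i \<otimes> (\<omega> \<otimes> resolvent \<omega> ((x [^] (q ^ i)) [^] q))"
    using assms w resolvent_closed by (simp add: frobenius_power_Suc m_assoc del: power_Suc)
  then show ?case using Suc resolvent_frobenius[OF assms(1), of "x [^] (q ^ i)"] assms by simp
qed

text \<open>
  Since \<open>\<omega>\<close> lies in \<open>K\<close>, raising the resolvent to the power \<open>q\<close> acts on its argument only. So all
  nonzero resolvents for the same \<open>\<omega>\<close> are eigenvectors for the same eigenvalue, and their
  quotients are fixed by the Frobenius map.
\<close>

lemma frobenius_resolvent:
  assumes "\<omega> \<in> roots_of_unity" "x \<in> carrier L"
  shows "\<omega> \<otimes> resolvent \<omega> x [^] q = resolvent \<omega> x"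
proof -
  have w: "\<omega> \<in> carrier L" using assms root_of_unityD by auto
  have "resolvent \<omega> x [^] q = (\<Oplus>i\<in>{..<n}. (\<omega> [^] i \<otimes> x [^] (q ^ i)) [^] q)"
    unfolding resolvent_def using assms w by (intro frobenius_finsum) auto
  also have "\<dots> = resolvent \<omega> (x [^] q)"
    unfolding resolvent_def
  proof (intro finsum_cong')
    fix i :: nat
    have "(\<omega> [^] i) [^] q = \<omega> [^] i"
      using in_K_iff[of "\<omega> [^] i"] root_of_unityD(3)[OF root_of_unity_pow[OF assms(1)]] w by simp
    then show "(\<omega> [^] i \<otimes> x [^] (q ^ i)) [^] q = \<omega> [^] i \<otimes> (x [^] q) [^] (q ^ i)"
      using assms w by (simp add: nat_pow_distrib nat_pow_pow mult.commute)
  qed (use assms w in auto)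
  finally show ?thesis using resolvent_frobenius[OF assms] by simp
qed

text \<open>
  The resolvents are the values at the roots of unity of a polynomial with coefficients
  \<open>x ^ (q ^ i)\<close>; if they all vanish, so does the constant coefficient \<open>x\<close>.
\<close>

lemma eq_zero_if_resolvents_zero:
  assumes "x \<in> carrier L" "\<And>\<omega>. \<omega> \<in> roots_of_unity \<Longrightarrow> resolvent \<omega> x = \<zero>"
  shows "x = \<zero>"
proof -
  have "x [^] (q ^ 0) = \<zero>"
  proof (rule coefficients_zero_at_roots_of_unity[of "\<lambda>i. x [^] (q ^ i)"])
    fix \<omega> assume w: "\<omega> \<in> roots_of_unity"
    have "(\<Oplus>i\<in>{..<n}. x [^] (q ^ i) \<otimes> \<omega> [^] i) = resolvent \<omega> x"
      unfolding resolvent_def using assms root_of_unityD[OF w]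
      by (intro finsum_cong') (auto simp: m_comm)
    then show "(\<Oplus>i\<in>{..<n}. x [^] (q ^ i) \<otimes> \<omega> [^] i) = \<zero>" using assms w by simp
  qed (use assms n_pos in auto)
  then show ?thesis using assms by simp
qed

text \<open>
  A vanishing resolvent is itself a nontrivial relation between the conjugates. Conversely, a
  relation \<open>\<Sum>i. c i * x ^ (q ^ i) = 0\<close> is mapped by the resolvent at \<open>inv \<omega>\<close> to
  \<open>(\<Sum>i. c i * \<omega> ^ i) * resolvent (inv \<omega>) x = 0\<close>. If no resolvent vanishes, then the polynomial
  with coefficients \<open>c\<close> vanishes at all \<open>n\<close> roots of unity and is zero.
\<close>

lemma normal_element_iff_resolvents_nonzero:
  assumes x: "x \<in> carrier L"
  shows "normal_element L K q n x \<longleftrightarrow> (\<forall>\<omega>\<in>roots_of_unity. resolvent \<omega> x \<noteq> \<zero>)"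
proof -
  have "normal_element L K q n x \<longleftrightarrow> (\<forall>c. (\<forall>i<n. c i \<in> K) \<longrightarrow>
      (\<Oplus>i\<in>{..<n}. c i \<otimes> x [^] (q ^ i)) = \<zero> \<longrightarrow> (\<forall>i<n. c i = \<zero>))"
    unfolding normal_element_def
    using x independent_map_upt_iff[OF subfield_K, of n "\<lambda>i. x [^] (q ^ i)"] by simp
  also have "\<dots> \<longleftrightarrow> (\<forall>\<omega>\<in>roots_of_unity. resolvent \<omega> x \<noteq> \<zero>)" (is "?indep \<longleftrightarrow> ?nz")
  proof
    assume indep: ?indep
    show ?nz
    proof (intro ballI notI)
      fix \<omega> assume w: "\<omega> \<in> roots_of_unity" and "resolvent \<omega> x = \<zero>"
      then have "(\<Oplus>i\<in>{..<n}. \<omega> [^] i \<otimes> x [^] (q ^ i)) = \<zero>" by (simp only: resolvent_def)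
      moreover have "\<forall>i<n. \<omega> [^] i \<in> K" using root_of_unityD(3)[OF root_of_unity_pow[OF w]] by simp
      moreover note spec[OF indep, of "\<lambda>i. \<omega> [^] i"]
      ultimately have "\<forall>i<n. \<omega> [^] i = \<zero>" by (elim impE)
      from spec[OF this, of 0] show False using n_pos by simp
    qed
  next
    assume nz: ?nz
    show ?indep
    proof (intro allI impI)
      fix c j assume c: "\<forall>i<n. c i \<in> K" and eq: "(\<Oplus>i\<in>{..<n}. c i \<otimes> x [^] (q ^ i)) = \<zero>"
        and j: "j < n"
      have cL: "c i \<in> carrier L" if "i < n" for i using that c K_subset by auto
      show "c j = \<zero>"
      proof (rule coefficients_zero_at_roots_of_unity[OF cL _ j])
        fix \<omega> assume w: "\<omega> \<in> roots_of_unity"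
        note w' = inv_root_of_unity[OF w]
        have U: "\<omega> \<in> Units L" using root_of_unityD[OF w] field_Units by auto
        have wL: "\<omega> \<in> carrier L" "inv \<omega> \<in> carrier L" using U by auto
        define r where "r = resolvent (inv \<omega>) x"
        have r: "r \<in> carrier L" "r \<noteq> \<zero>" using nz w' resolvent_closed x by (auto simp: r_def)
        have shift: "resolvent (inv \<omega>) (x [^] (q ^ i)) = \<omega> [^] i \<otimes> r" for i
        proof -
          have "r = inv \<omega> [^] i \<otimes> resolvent (inv \<omega>) (x [^] (q ^ i))"
            using resolvent_frobenius_power[OF w' x] by (simp add: r_def)
          then have "\<omega> [^] i \<otimes> r = (\<omega> \<otimes> inv \<omega>) [^] i \<otimes> resolvent (inv \<omega>) (x [^] (q ^ i))"
            using wL resolvent_closed[OF w'] x by (simp add: nat_pow_distrib m_assoc)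
          then show ?thesis using U resolvent_closed[OF w'] x by simp
        qed
        have "\<zero> = resolvent (inv \<omega>) (\<Oplus>i\<in>{..<n}. c i \<otimes> x [^] (q ^ i))"
          using eq resolvent_zero[OF w'] by simp
        also have "\<dots> = (\<Oplus>i\<in>{..<n}. resolvent (inv \<omega>) (c i \<otimes> x [^] (q ^ i)))"
          using x cL by (intro resolvent_finsum[OF w']) auto
        also have "\<dots> = (\<Oplus>i\<in>{..<n}. c i \<otimes> \<omega> [^] i \<otimes> r)"
          using x c cL wL r by (intro finsum_cong') (auto simp: resolvent_smult[OF w'] shift m_assoc)
        also have "\<dots> = (\<Oplus>i\<in>{..<n}. c i \<otimes> \<omega> [^] i) \<otimes> r"
          using cL wL r by (intro finsum_ldistr[symmetric]) auto
        finally show "(\<Oplus>i\<in>{..<n}. c i \<otimes> \<omega> [^] i) = \<zero>"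
          using r cL wL integral[of "\<Oplus>i\<in>{..<n}. c i \<otimes> \<omega> [^] i" r]
          by (auto intro!: finsum_closed)
      qed
    qed
  qed
  finally show ?thesis .
qed

section \<open>Coordinates relative to a normal element\<close>

text \<open>
  The coordinates of \<open>x\<close> in the basis of \<open>L\<close> formed by the components of \<open>a\<close> in the Frobenius
  eigenspaces. The restriction to the roots of unity makes them an element of the extensional
  function space, so that functions can be counted.
\<close>

definition coordinates :: "'a \<Rightarrow> 'a \<Rightarrow> 'a \<Rightarrow> 'a" where
  "coordinates a x = (\<lambda>\<omega>\<in>roots_of_unity. resolvent \<omega> x \<otimes> inv (resolvent \<omega> a))"

lemma resolvent_unit:
  assumes "normal_element L K q n a" "\<omega> \<in> roots_of_unity"
  shows "resolvent \<omega> a \<in> Units L"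
  using assms normal_element_iff_resolvents_nonzero[of a] resolvent_closed[of \<omega> a] field_Units
  by (auto simp: normal_element_def)

lemma resolvent_eq_coordinates:
  assumes "normal_element L K q n a" "x \<in> carrier L" "\<omega> \<in> roots_of_unity"
  shows "coordinates a x \<omega> \<in> carrier L" "resolvent \<omega> x = coordinates a x \<omega> \<otimes> resolvent \<omega> a"
proof -
  define r where "r = resolvent \<omega> a"
  have r: "r \<in> Units L" using resolvent_unit[OF assms(1,3)] by (simp add: r_def)
  have "coordinates a x \<omega> = resolvent \<omega> x \<otimes> inv r"
    using assms(3) by (simp add: coordinates_def r_def)
  moreover have "r \<in> carrier L" "inv r \<in> carrier L" using r by (rule Units_closed, rule Units_inv_closed)
  ultimately show "coordinates a x \<omega> \<in> carrier L"
    "resolvent \<omega> x = coordinates a x \<omega> \<otimes> resolvent \<omega> a"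
    using resolvent_closed[OF assms(3,2)] Units_l_inv[OF r]
    by (simp_all add: m_assoc r_def[symmetric])
qed

lemma coordinates_in_K:
  assumes a: "normal_element L K q n a" and x: "x \<in> carrier L" and w: "\<omega> \<in> roots_of_unity"
  shows "coordinates a x \<omega> \<in> K"
proof -
  define t where "t = coordinates a x \<omega>"
  define r where "r = resolvent \<omega> a"
  have aL: "a \<in> carrier L" using a by (simp add: normal_element_def)
  have wL: "\<omega> \<in> carrier L" using root_of_unityD[OF w] by simp
  have t: "t \<in> carrier L" "resolvent \<omega> x = t \<otimes> r"
    using resolvent_eq_coordinates[OF a x w] by (simp_all add: t_def r_def)
  have rU: "r \<in> Units L" using resolvent_unit[OF a w] by (simp add: r_def)
  then have r: "r \<in> carrier L" and r0: "r \<noteq> \<zero>" using field_Units by auto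
  have "t \<otimes> r = \<omega> \<otimes> (t \<otimes> r) [^] q" using frobenius_resolvent[OF w x] t by simp
  also have "\<dots> = t [^] q \<otimes> (\<omega> \<otimes> r [^] q)"
    using t r wL by (simp add: nat_pow_distrib m_lcomm)
  also have "\<omega> \<otimes> r [^] q = r" using frobenius_resolvent[OF w aL] by (simp add: r_def)
  finally have "t \<otimes> r = t [^] q \<otimes> r" .
  then have "t [^] q = t" using t r r0 m_rcancel[OF r0 r] by simp
  then show ?thesis using in_K_iff t by (simp add: t_def)
qed

text \<open>
  Injectivity is the vanishing criterion for resolvents; surjectivity then follows because
  both sides have \<open>q ^ n\<close> elements.
\<close>

lemma bij_betw_coordinates:
  assumes a: "normal_element L K q n a"
  shows "bij_betw (coordinates a) (carrier L) (roots_of_unity \<rightarrow>\<^sub>E K)"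
proof -
  have "inj_on (coordinates a) (carrier L)"
  proof (rule inj_onI)
    fix x y assume xy: "x \<in> carrier L" "y \<in> carrier L" "coordinates a x = coordinates a y"
    have "resolvent \<omega> (x \<ominus> y) = \<zero>" if w: "\<omega> \<in> roots_of_unity" for \<omega>
    proof -
      have "resolvent \<omega> x = resolvent \<omega> y"
        using resolvent_eq_coordinates(2)[OF a _ w] xy by simp
      then show ?thesis using resolvent_minus[OF w xy(1,2)] resolvent_closed[OF w] xy by simp
    qed
    then show "x = y" using eq_zero_if_resolvents_zero[of "x \<ominus> y"] xy by simp
  qed
  moreover have "coordinates a ` carrier L = roots_of_unity \<rightarrow>\<^sub>E K"
  proof (rule card_seteq)
    show "finite (roots_of_unity \<rightarrow>\<^sub>E K)" using finite_roots_of_unity finite_K by (intro finite_PiE) auto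
    show "coordinates a ` carrier L \<subseteq> roots_of_unity \<rightarrow>\<^sub>E K"
      using coordinates_in_K[OF a] by (auto simp: coordinates_def)
    show "card (roots_of_unity \<rightarrow>\<^sub>E K) \<le> card (coordinates a ` carrier L)"
      using card_image[OF calculation] order_L
      by (simp add: card_PiE finite_roots_of_unity card_roots_of_unity card_K order_def)
  qed
  ultimately show ?thesis by (simp add: bij_betw_def)
qed

text \<open>
  Passing from \<open>x\<close> to \<open>x ^ (q ^ i)\<close> divides the coordinate at \<open>\<omega>\<close> by \<open>\<omega> ^ i\<close>, and all coordinates
  of \<open>a\<close> are \<open>1\<close>. So \<open>x ^ (q ^ i)\<close> is normal iff no coordinate of \<open>x\<close> is zero, and
  \<open>x ^ (q ^ i) - a\<close> is normal iff no coordinate of \<open>x\<close> equals the corresponding \<open>\<omega> ^ i\<close>.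
\<close>

lemma two_sociable_iff:
  assumes a: "normal_element L K q n a" and x: "x \<in> carrier L"
  shows "two_sociable L K q n a x \<longleftrightarrow>
    (\<forall>\<omega>\<in>roots_of_unity. coordinates a x \<omega> \<notin> insert \<zero> (range (\<lambda>i::nat. \<omega> [^] i)))"
proof -
  have aL: "a \<in> carrier L" using a by (simp add: normal_element_def)
  have zero: "resolvent \<omega> (x [^] (q ^ i)) = \<zero> \<longleftrightarrow> coordinates a x \<omega> = \<zero>"
    and diff: "resolvent \<omega> (x [^] (q ^ i) \<ominus> a) = \<zero> \<longleftrightarrow> coordinates a x \<omega> = \<omega> [^] i"
    if w: "\<omega> \<in> roots_of_unity" for \<omega> i
  proof -
    define r where "r = resolvent \<omega> a"
    define s where "s = resolvent \<omega> (x [^] (q ^ i))"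
    define t where "t = coordinates a x \<omega>"
    have wL: "\<omega> [^] i \<in> carrier L" "\<omega> [^] i \<noteq> \<zero>"
      using root_of_unityD(1,4)[OF root_of_unity_pow[OF w]] by auto
    have rU: "r \<in> Units L" using resolvent_unit[OF a w] by (simp add: r_def)
    then have r: "r \<in> carrier L" "r \<noteq> \<zero>" using field_Units by auto
    have s: "s \<in> carrier L" using resolvent_closed[OF w] x by (simp add: s_def)
    have t: "t \<in> carrier L" "\<omega> [^] i \<otimes> s = t \<otimes> r"
      using resolvent_eq_coordinates[OF a x w] resolvent_frobenius_power[OF w x]
      by (simp_all add: t_def r_def s_def)
    show "resolvent \<omega> (x [^] (q ^ i)) = \<zero> \<longleftrightarrow> coordinates a x \<omega> = \<zero>"
      using t wL r s integral_iff unfolding s_def[symmetric] t_def[symmetric] by (metis r_null l_null)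
    have "resolvent \<omega> (x [^] (q ^ i) \<ominus> a) = \<zero> \<longleftrightarrow> s = r"
      using resolvent_minus[OF w, of "x [^] (q ^ i)" a] x aL s r by (simp add: s_def r_def)
    also have "\<dots> \<longleftrightarrow> \<omega> [^] i \<otimes> s = \<omega> [^] i \<otimes> r"
      using m_lcancel[OF wL(2,1)] s r by simp
    also have "\<dots> \<longleftrightarrow> t = \<omega> [^] i"
      using m_rcancel[OF r(2,1)] t wL by auto
    finally show "resolvent \<omega> (x [^] (q ^ i) \<ominus> a) = \<zero> \<longleftrightarrow> coordinates a x \<omega> = \<omega> [^] i"
      by (simp add: t_def)
  qed
  have "two_sociable L K q n a x \<longleftrightarrow> (\<forall>i. \<forall>\<omega>\<in>roots_of_unity.
      resolvent \<omega> (x [^] (q ^ i)) \<noteq> \<zero> \<and> resolvent \<omega> (x [^] (q ^ i) \<ominus> a) \<noteq> \<zero>)"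
    unfolding two_sociable_def normal_depth_two_def
    using x aL by (auto simp: normal_element_iff_resolvents_nonzero)
  also have "\<dots> \<longleftrightarrow>
      (\<forall>\<omega>\<in>roots_of_unity. coordinates a x \<omega> \<notin> insert \<zero> (range (\<lambda>i::nat. \<omega> [^] i)))"
    using zero diff by auto
  finally show ?thesis .
qed

lemma card_two_sociable:
  assumes a: "normal_element L K q n a"
  shows "int (card {x \<in> carrier L. two_sociable L K q n a x}) =
    (\<Prod>i = 1..n. int q - int (n div gcd i n) - 1)"
proof -
  \<comment> \<open>The entries that \<open>two_sociable_iff\<close> excludes at \<open>\<omega>\<close>.\<close>
  define bad where "bad \<omega> = insert \<zero> (range (\<lambda>i::nat. \<omega> [^] i))" for \<omega>
  obtain \<zeta> where bij: "bij_betw (\<lambda>i. \<zeta> [^] i) {1..n} roots_of_unity"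
    and card_bad: "\<And>i. i \<in> {1..n} \<Longrightarrow> card (bad (\<zeta> [^] i)) = Suc (n div gcd i n)"
    using primitive_root unfolding bad_def by blast
  have bad_K: "bad \<omega> \<subseteq> K" if "\<omega> \<in> roots_of_unity" for \<omega>
    using root_of_unityD(3)[OF root_of_unity_pow[OF that]] zero_one_in_K by (auto simp: bad_def)
  have "coordinates a ` {x \<in> carrier L. two_sociable L K q n a x} =
      (\<Pi>\<^sub>E \<omega>\<in>roots_of_unity. K - bad \<omega>)" (is "_ ` ?S = ?T")
  proof
    show "coordinates a ` ?S \<subseteq> ?T"
      using two_sociable_iff[OF a] coordinates_in_K[OF a]
      by (auto simp: bad_def[symmetric] coordinates_def[of a] PiE_iff)
    show "?T \<subseteq> coordinates a ` ?S"
    proof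
      fix f assume f: "f \<in> ?T"
      then have "f \<in> roots_of_unity \<rightarrow>\<^sub>E K" by (auto simp: PiE_iff)
      then obtain x where x: "x \<in> carrier L" "f = coordinates a x"
        using bij_betw_imp_surj_on[OF bij_betw_coordinates[OF a]] by blast
      then have "two_sociable L K q n a x"
        using two_sociable_iff[OF a x(1)] f by (auto simp: bad_def[symmetric] PiE_iff)
      then show "f \<in> coordinates a ` ?S" using x by auto
    qed
  qed
  moreover have "inj_on (coordinates a) ?S"
    using bij_betw_imp_inj_on[OF bij_betw_coordinates[OF a]] by (rule inj_on_subset) auto
  ultimately have "card ?S = card ?T" using card_image by metis
  also have "\<dots> = (\<Prod>\<omega>\<in>roots_of_unity. card (K - bad \<omega>))"
    by (intro card_PiE finite_roots_of_unity)
  also have "\<dots> = (\<Prod>i\<in>{1..n}. card (K - bad (\<zeta> [^] i)))"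
    by (intro prod.reindex_bij_betw[symmetric] bij)
  finally have "int (card ?S) = (\<Prod>i\<in>{1..n}. int (card (K - bad (\<zeta> [^] i))))" by simp
  also have "\<dots> = (\<Prod>i = 1..n. int q - int (n div gcd i n) - 1)"
  proof (rule prod.cong)
    fix i assume i: "i \<in> {1..n}"
    then have "\<zeta> [^] i \<in> roots_of_unity" using bij by (auto simp: bij_betw_def)
    then have sub: "bad (\<zeta> [^] i) \<subseteq> K" by (rule bad_K)
    \<comment> \<open>No truncation occurs: the excluded values all lie in \<open>K\<close>, so there are at most \<open>q\<close>.\<close>
    then have "card (K - bad (\<zeta> [^] i)) = q - Suc (n div gcd i n)" "Suc (n div gcd i n) \<le> q"
      using finite_K card_bad[OF i] card_mono[OF finite_K sub] card_K
      by (auto simp: card_Diff_subset finite_subset)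
    then show "int (card (K - bad (\<zeta> [^] i))) = int q - int (n div gcd i n) - 1" by simp
  qed simp
  finally show ?thesis .
qed

end

theorem proposition7:
  fixes L :: "('a, 'b) ring_scheme" and K :: "'a set" and q n :: nat and \<alpha> :: 'a
  assumes "primepow q" and "n \<ge> 1"
    and "field L" and "order L = q ^ n"
    and "subfield K L" and "card K = q"
    and "normal_element L K q n \<alpha>"
    and "n dvd q - 1"
  shows "int (card {\<beta> \<in> carrier L. two_sociable L K q n \<alpha> \<beta>}) =
    (\<Prod>i = 1..n. int q - int (n div gcd i n) - 1)"
proof -
  interpret field L by fact
  have "q > 0" using assms(1) by (rule primepow_gt_0_nat)
  \<comment> \<open>An infinite carrier would have order 0.\<close>
  then have fin: "finite (carrier L)" using assms(4) by (intro card_ge_0_finite) (simp add: order_def)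
  interpret cyclic_extension L K q n
    by (intro cyclic_extension.intro cyclic_extension_axioms.intro) fact+
  show ?thesis using assms(7) by (rule card_two_sociable)
qed

end
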